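(* Let $n\ge 1$ and let $G \subseteq GL_n(\mathbb{C})$ be a nontrivial finite matrix group. Then $\mathrm{HS}(G)$ is star-shaped from every point in the real interval $[0,1]$.
   Context: For a set $S \subseteq M_n(\mathbb{C})$, $\mathrm{Co}(S)$ denotes the set of all (finite) convex combinations of elements of $S$, and the hull spectrum $\mathrm{HS}(S)\subseteq\mathbb{C}$ is the set of all complex numbers that occur as eigenvalues of some matrix in $\mathrm{Co}(S)$. A set $X\subseteq\mathbb{C}$ is star-shaped from $\lambda$ if $\lambda\in X$ and for every $\lambda'\in X$ the whole line segment between $\lambda$ and $\lambda'$ is contained in $X$. *)

theory Defs
  imports "HOL-Analysis.Analysis" "HOL-Algebra.Group"
begin

definition GL :: "(complex ^ 'n ^ 'n) monoid" where
  "GL = \<lparr>carrier = {A. invertible A}, mult = (**), one = mat 1\<rparr>"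

lemma GL_simps:
  "carrier GL = {A. invertible A}"
  "x \<otimes>\<^bsub>GL\<^esub> y = x ** y"
  "\<one>\<^bsub>GL\<^esub> = mat 1"
  by (simp_all add: GL_def)

lemma group_GL: "group GL"
proof (rule groupI)
  fix x :: "complex ^ 'n ^ 'n" assume "x \<in> carrier GL"
  then show "\<exists>y\<in>carrier GL. y \<otimes>\<^bsub>GL\<^esub> x = \<one>\<^bsub>GL\<^esub>"
    by (auto simp: GL_simps invertible_def)
next
  show "\<one>\<^bsub>GL\<^esub> \<in> carrier GL"
    by (auto simp: GL_simps invertible_def intro: exI [of _ "mat 1"])
qed (auto simp: GL_simps matrix_mul_assoc intro: invertible_mult)

definition eigenvalue :: "complex ^ 'n ^ 'n \<Rightarrow> complex \<Rightarrow> bool" where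
  "eigenvalue A \<mu> \<longleftrightarrow> (\<exists>v. v \<noteq> 0 \<and> A *v v = \<mu> *s v)"

(* "convex hull S" consists of the finite convex combinations of elements of S
   with real coefficients, see convex_hull_explicit. *)
definition hull_spectrum :: "(complex ^ 'n ^ 'n) set \<Rightarrow> complex set" where
  "hull_spectrum S = {\<mu>. \<exists>A \<in> convex hull S. eigenvalue A \<mu>}"

(* The library's starlike X only asserts that X is star-shaped from some point. *)
definition star_shaped_from :: "complex set \<Rightarrow> complex \<Rightarrow> bool" where
  "star_shaped_from X \<mu> \<longleftrightarrow> \<mu> \<in> X \<and> (\<forall>\<nu>\<in>X. closed_segment \<mu> \<nu> \<subseteq> X)"

end

theory Submission
  imports Defs
begin

text \<open>
  The average \<open>P\<close> of \<open>G\<close> satisfies \<open>P A = P\<close> for every \<open>A\<close> in the convex hull of \<open>G\<close>, so it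
  annihilates every eigenvector of \<open>A\<close> whose eigenvalue \<open>\<nu>\<close> differs from \<open>1\<close>. On such a vector
  the convex combination \<open>a I + b P + c A\<close> acts as \<open>a + c \<nu>\<close>, and these values fill the triangle
  with vertices \<open>0\<close>, \<open>1\<close> and \<open>\<nu>\<close>. For the eigenvalue \<open>1\<close> only \<open>[0,1]\<close> has to be covered, which
  the combinations \<open>a I + (1 - a) P\<close> do on a vector \<open>g w - w \<noteq> 0\<close>.
\<close>

lemma scaleR_matrix_vector_mult:
  fixes A :: "'a::real_algebra_1 ^ 'n ^ 'm"
  shows "(r *\<^sub>R A) *v v = r *\<^sub>R (A *v v)"
  by (simp add: vec_eq_iff matrix_vector_mult_def scaleR_sum_right)

lemma matrix_vector_mult_scaleR:
  fixes A :: "'a::real_algebra_1 ^ 'n ^ 'm"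
  shows "A *v (r *\<^sub>R v) = r *\<^sub>R (A *v v)"
  by (simp add: vec_eq_iff matrix_vector_mult_def scaleR_sum_right)

lemma sum_matrix_vector_mult:
  fixes f :: "'i \<Rightarrow> 'a::semiring_1 ^ 'n ^ 'm"
  shows "(\<Sum>i\<in>I. f i) *v v = (\<Sum>i\<in>I. f i *v v)"
  by (induction I rule: infinite_finite_induct)
    (simp_all add: matrix_vector_mult_add_rdistrib)

text \<open>Right multiplication by \<open>g\<close> permutes \<open>G\<close>, so it only reorders
  the sum. The unnormalised sum avoids carrying the factor \<open>1 / card G\<close>.\<close>

lemma sum_subgroup_absorbs:
  fixes G :: "(complex ^ 'n ^ 'n) set"
  assumes "subgroup G GL" and "g \<in> G"
  shows "\<Sum>G *v (g *v v) = \<Sum>G *v v"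
proof -
  interpret GL: group "GL :: (complex ^ 'n ^ 'n) monoid" by (rule group_GL)
  have "bij_betw (\<lambda>h. h ** g) G G"
  \<comment> \<open>The inverse map is written with the operations of \<open>GL\<close>, so that the
    group laws cancel \<open>g\<close> against its inverse.\<close>
  proof (rule bij_betw_byWitness[where f' = "\<lambda>h. h \<otimes>\<^bsub>GL\<^esub> inv\<^bsub>GL\<^esub> g"])
    have carr: "h \<in> carrier GL" if "h \<in> G" for h
      using assms(1) that by (rule subgroup.mem_carrier)
    show "\<forall>h\<in>G. (h ** g) \<otimes>\<^bsub>GL\<^esub> inv\<^bsub>GL\<^esub> g = h"
      unfolding GL_simps(2)[symmetric] using carr assms(2) by (simp add: GL.m_assoc)
    show "\<forall>h\<in>G. (h \<otimes>\<^bsub>GL\<^esub> inv\<^bsub>GL\<^esub> g) ** g = h"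
      unfolding GL_simps(2)[symmetric] using carr assms(2) by (simp add: GL.m_assoc)
    show "(\<lambda>h. h ** g) ` G \<subseteq> G"
      unfolding GL_simps(2)[symmetric] using assms by (auto intro: subgroup.m_closed)
    show "(\<lambda>h. h \<otimes>\<^bsub>GL\<^esub> inv\<^bsub>GL\<^esub> g) ` G \<subseteq> G"
      using assms by (auto intro: subgroup.m_closed subgroup.m_inv_closed)
  qed
  then have "(\<Sum>h\<in>G. (h ** g) *v v) = (\<Sum>h\<in>G. h *v v)"
    by (rule sum.reindex_bij_betw)
  then show ?thesis
    by (simp add: sum_matrix_vector_mult flip: matrix_vector_mul_assoc)
qed

text \<open>For fixed \<open>v\<close> the condition is affine in \<open>A\<close>, so its solutions
  form a convex set, which contains \<open>G\<close>.\<close>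

lemma sum_subgroup_absorbs_hull:
  fixes G :: "(complex ^ 'n ^ 'n) set"
  assumes "subgroup G GL" and "A \<in> convex hull G"
  shows "\<Sum>G *v (A *v v) = \<Sum>G *v v"
proof -
  let ?C = "{A. \<Sum>G *v (A *v v) = \<Sum>G *v v}"
  have "convex ?C"
  proof (rule convexI)
    fix A B :: "complex ^ 'n ^ 'n" and a b :: real
    assume "A \<in> ?C" "B \<in> ?C" "a + b = 1"
    then show "a *\<^sub>R A + b *\<^sub>R B \<in> ?C"
      by (simp add: matrix_vector_mult_add_rdistrib scaleR_matrix_vector_mult
          matrix_vector_right_distrib matrix_vector_mult_scaleR flip: scaleR_add_left)
  qed
  moreover have "G \<subseteq> ?C"
    using sum_subgroup_absorbs[OF assms(1)] by blast
  ultimately have "convex hull G \<subseteq> ?C" by (simp add: hull_minimal)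
  with assms(2) show ?thesis by blast
qed

lemma average_in_convex_hull:
  fixes S :: "'a::real_vector set"
  assumes "finite S" and "S \<noteq> {}"
  shows "(1 / real (card S)) *\<^sub>R \<Sum>S \<in> convex hull S"
proof -
  have "(\<Sum>x\<in>S. (1 / real (card S)) *\<^sub>R x) \<in> convex hull S"
    using assms by (intro convex_sum) (auto intro: hull_inc)
  then show ?thesis by (simp add: scaleR_sum_right)
qed

text \<open>The average takes the weight \<open>1 - a - c\<close> left over by \<open>mat 1\<close>
  and \<open>A\<close>; since it kills \<open>v\<close>, it supplies the vertex 0 of the
  triangle.\<close>

lemma hull_spectrum_contains_triangle:
  fixes G :: "(complex ^ 'n ^ 'n) set"
  assumes G: "finite G" "mat 1 \<in> G"
    and A: "A \<in> convex hull G" "A *v v = \<nu> *s v" "v \<noteq> 0" "\<Sum>G *v v = 0"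
    and ac: "0 \<le> a" "0 \<le> c" "a + c \<le> 1"
  shows "complex_of_real a + complex_of_real c * \<nu> \<in> hull_spectrum G"
proof -
  define P where "P = (1 / real (card G)) *\<^sub>R \<Sum>G"
  let ?B = "a *\<^sub>R mat 1 + (1 - a - c) *\<^sub>R P + c *\<^sub>R A"
  have "P \<in> convex hull G"
    unfolding P_def using G by (intro average_in_convex_hull) auto
  moreover have "mat 1 \<in> convex hull G" using G(2) by (rule hull_inc)
  ultimately have "?B \<in> convex hull G"
    \<comment> \<open>The three-term combination is written as a sum over three indices.\<close>
    using convex_sum[of "{0, 1, 2::nat}" "convex hull G"
        "\<lambda>i. if i = 0 then a else if i = 1 then 1 - a - c else c"
        "\<lambda>i. if i = 0 then mat 1 else if i = 1 then P else A"] A(1) ac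
    by (simp add: add.assoc)
  moreover have "?B *v v = (complex_of_real a + complex_of_real c * \<nu>) *s v"
    unfolding P_def using A(2,4)
    by (simp add: matrix_vector_mult_add_rdistrib scaleR_matrix_vector_mult)
      (simp add: vec_eq_iff, simp add: scaleR_conv_of_real algebra_simps)
  ultimately show ?thesis
    using A(3) by (auto simp: hull_spectrum_def eigenvalue_def)
qed

text \<open>The sum takes the same value on \<open>g *v w\<close> and \<open>w\<close>, hence kills
  their difference, which is nonzero for a suitable \<open>w\<close> once \<open>g\<close> is not
  the identity.\<close>

lemma exists_vector_annihilated_by_sum:
  fixes G :: "(complex ^ 'n ^ 'n) set"
  assumes "subgroup G GL" and "G \<noteq> {mat 1}"
  obtains v where "v \<noteq> 0" and "\<Sum>G *v v = 0"
proof -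
  have "mat 1 \<in> G" using subgroup.one_closed[OF assms(1)] by (simp add: GL_simps)
  then obtain g where g: "g \<in> G" "g \<noteq> mat 1" using assms(2) by blast
  then obtain w where "g *v w \<noteq> w"
    by (metis matrix_eq matrix_vector_mul_lid)
  moreover have "\<Sum>G *v (g *v w - w) = 0"
    using sum_subgroup_absorbs[OF assms(1) g(1)] by (simp add: matrix_vector_mult_diff_distrib)
  ultimately show thesis using that[of "g *v w - w"] by simp
qed

theorem corollary2p8:
  fixes G :: "(complex ^ 'n ^ 'n) set"
  assumes "subgroup G GL"
    and "finite G"
    and "G \<noteq> {mat 1}"
  shows "\<forall>t::real. 0 \<le> t \<and> t \<le> 1 \<longrightarrow> star_shaped_from (hull_spectrum G) (complex_of_real t)"
proof (intro allI impI)
  fix t :: real assume t: "0 \<le> t \<and> t \<le> 1"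
  have one: "mat 1 \<in> G" using subgroup.one_closed[OF assms(1)] by (simp add: GL_simps)
  obtain w where w: "w \<noteq> 0" "\<Sum>G *v w = 0"
    using exists_vector_annihilated_by_sum[OF assms(1,3)] .
  \<comment> \<open>The triangle for the matrix \<open>mat 1\<close> with eigenvector
    \<open>w\<close>, eigenvalue 1 and \<open>c = 0\<close>.\<close>
  have unit_interval: "complex_of_real a \<in> hull_spectrum G" if "0 \<le> a" "a \<le> 1" for a
    using hull_spectrum_contains_triangle[OF assms(2) one hull_inc[OF one], of w 1 a 0] w that
    by simp
  have "closed_segment (complex_of_real t) \<nu> \<subseteq> hull_spectrum G" if \<nu>: "\<nu> \<in> hull_spectrum G" for \<nu>
  proof
    fix z assume "z \<in> closed_segment (complex_of_real t) \<nu>"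
    then obtain u where u: "0 \<le> u" "u \<le> 1"
      and z: "z = complex_of_real ((1 - u) * t) + complex_of_real u * \<nu>"
      by (auto simp: in_segment scaleR_conv_of_real)
    \<comment> \<open>These are the triangle's constraints for \<open>a = (1 - u) * t\<close> and
      \<open>c = u\<close>; the second rests on \<open>t \<le> 1\<close>.\<close>
    have bound: "0 \<le> (1 - u) * t" "(1 - u) * t + u \<le> 1"
      using t u mult_left_mono[of t 1 "1 - u"] by auto
    show "z \<in> hull_spectrum G"
    proof (cases "\<nu> = 1")
      \<comment> \<open>The sum need not kill an eigenvector for 1, but here \<open>z\<close> is a
        real number in [0,1].\<close>
      case True
      then have "z = complex_of_real ((1 - u) * t + u)" using z by simp
      then show ?thesis using unit_interval[of "(1 - u) * t + u"] bound u by simp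
    next
      case False
      obtain A v where A: "A \<in> convex hull G" "v \<noteq> 0" "A *v v = \<nu> *s v"
        using \<nu> by (auto simp: hull_spectrum_def eigenvalue_def)
      \<comment> \<open>Apply the sum to both sides of \<open>A *v v = \<nu> *s v\<close>; on the
        left \<open>A\<close> is absorbed.\<close>
      have "\<Sum>G *v v = \<nu> *s (\<Sum>G *v v)"
        using sum_subgroup_absorbs_hull[OF assms(1) A(1), of v] A(3)
        by (simp add: vector_scalar_commute)
      then have "\<Sum>G *v v = 0" using False by (simp add: vec_eq_iff)
      then show ?thesis
        unfolding z using assms(2) one A bound u
        by (intro hull_spectrum_contains_triangle[of G A v]) auto
    qed
  qed
  then show "star_shaped_from (hull_spectrum G) (complex_of_real t)"
    using unit_interval t by (simp add: star_shaped_from_def)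
qed

end
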